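(* Assume $|\mathcal{A}_\tau|\geq 2$. Possible futures equivalence has no finite, ground-complete, equational axiomatisation over the language $\mathrm{BCCSP}_{\|}$ with CCS synchronisation.
   Context: Let $\mathcal{A}$ be a finite non-empty set of actions equipped with a bijection $a\mapsto\overline{a}$ on $\mathcal{A}$ with $\overline{\overline{a}}=a$ and $\overline{a}\neq a$ for all $a$; let $\tau\notin\mathcal{A}$ and $\mathcal{A}_\tau=\mathcal{A}\cup\{\tau\}$. Terms: $t ::= \mathbf{0} \mid x \mid \alpha.t \mid t+t \mid t\,\|\,t$ with $\alpha\in\mathcal{A}_\tau$ and $x$ ranging over a countably infinite set of variables; closed terms are processes. Transitions on processes: $\alpha.p\xrightarrow{\alpha}p$; if $p\xrightarrow{\alpha}p'$ then $p+q\xrightarrow{\alpha}p'$, $q+p\xrightarrow{\alpha}p'$, $p\|q\xrightarrow{\alpha}p'\|q$, $q\|p\xrightarrow{\alpha}q\|p'$; if $p\xrightarrow{a}p'$ and $q\xrightarrow{\overline{a}}q'$ with $a\in\mathcal{A}$ then $p\|q\xrightarrow{\tau}p'\|q'$. For $w\in\mathcal{A}_\tau^*$, $p\xrightarrow{w}p'$ denotes a path labelled $w$; $\mathtt{T}(p)$ is the set of such $w$. A possible future of $p$ is $(w,\mathtt{T}(p'))$ with $p\xrightarrow{w}p'$; $p\sim_{\mathtt{PF}}q$ iff $p,q$ have the same possible futures. A finite ground-complete axiomatisation is a finite set $\mathcal{E}$ of equations between terms, sound modulo $\sim_{\mathtt{PF}}$ (every closed instance of each equation relates $\sim_{\mathtt{PF}}$-equivalent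 processes), such that $p\sim_{\mathtt{PF}}q$ implies $\mathcal{E}\vdash p\approx q$ for all processes $p,q$, where $\vdash$ is derivability in equational logic (reflexivity, symmetry, transitivity, substitution instances, closure under $\alpha.\_$, $+$, $\|$). *)

theory Defs
  imports Main
begin

text \<open>
  The finite set of visible actions is a type \<open>'a\<close> of class \<open>finite\<close>; the complementation map
  \<open>bar\<close> is a parameter of everything that depends on it, and its properties are hypotheses
  of the theorem.
\<close>

datatype 'a act = Vis 'a | Tau

datatype 'a trm =
    Stop
  | Var nat
  | Prefix "'a act" "'a trm"
  | Plus "'a trm" "'a trm"
  | Par "'a trm" "'a trm"

fun vars :: "'a trm \<Rightarrow> nat set" where
  "vars Stop = {}"
| "vars (Var x) = {x}"
| "vars (Prefix \<alpha> t) = vars t"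
| "vars (Plus t u) = vars t \<union> vars u"
| "vars (Par t u) = vars t \<union> vars u"

definition process :: "'a trm \<Rightarrow> bool" where
  "process t \<longleftrightarrow> vars t = {}"

fun subst :: "(nat \<Rightarrow> 'a trm) \<Rightarrow> 'a trm \<Rightarrow> 'a trm" where
  "subst \<sigma> Stop = Stop"
| "subst \<sigma> (Var x) = \<sigma> x"
| "subst \<sigma> (Prefix \<alpha> t) = Prefix \<alpha> (subst \<sigma> t)"
| "subst \<sigma> (Plus t u) = Plus (subst \<sigma> t) (subst \<sigma> u)"
| "subst \<sigma> (Par t u) = Par (subst \<sigma> t) (subst \<sigma> u)"

text \<open>
  The rules are stated for arbitrary terms, but the relation is only ever used on processes. This is
  harmless: the transitions of a process are derived from transitions of its subterms, which
  are processes, and lead to processes.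
\<close>

inductive step :: "('a \<Rightarrow> 'a) \<Rightarrow> 'a trm \<Rightarrow> 'a act \<Rightarrow> 'a trm \<Rightarrow> bool"
  for bar :: "'a \<Rightarrow> 'a" where
  prefix: "step bar (Prefix \<alpha> p) \<alpha> p"
| plus_left: "step bar p \<alpha> p' \<Longrightarrow> step bar (Plus p q) \<alpha> p'"
| plus_right: "step bar p \<alpha> p' \<Longrightarrow> step bar (Plus q p) \<alpha> p'"
| par_left: "step bar p \<alpha> p' \<Longrightarrow> step bar (Par p q) \<alpha> (Par p' q)"
| par_right: "step bar p \<alpha> p' \<Longrightarrow> step bar (Par q p) \<alpha> (Par q p')"
| sync: "step bar p (Vis a) p' \<Longrightarrow> step bar q (Vis (bar a)) q' \<Longrightarrow>
    step bar (Par p q) Tau (Par p' q')"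

inductive path :: "('a \<Rightarrow> 'a) \<Rightarrow> 'a trm \<Rightarrow> 'a act list \<Rightarrow> 'a trm \<Rightarrow> bool"
  for bar :: "'a \<Rightarrow> 'a" where
  empty: "path bar p [] p"
| cons: "step bar p \<alpha> p' \<Longrightarrow> path bar p' w p'' \<Longrightarrow> path bar p (\<alpha> # w) p''"

definition traces :: "('a \<Rightarrow> 'a) \<Rightarrow> 'a trm \<Rightarrow> 'a act list set" where
  "traces bar p = {w. \<exists>p'. path bar p w p'}"

definition possible_futures :: "('a \<Rightarrow> 'a) \<Rightarrow> 'a trm \<Rightarrow> ('a act list \<times> 'a act list set) set" where
  "possible_futures bar p = {(w, traces bar p') | w p'. path bar p w p'}"

definition pf_equiv :: "('a \<Rightarrow> 'a) \<Rightarrow> 'a trm \<Rightarrow> 'a trm \<Rightarrow> bool" where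
  "pf_equiv bar p q \<longleftrightarrow> possible_futures bar p = possible_futures bar q"

text \<open>The equation \<open>t \<approx> u\<close> is represented by the pair \<open>(t, u)\<close>.\<close>

inductive derivable :: "('a trm \<times> 'a trm) set \<Rightarrow> 'a trm \<Rightarrow> 'a trm \<Rightarrow> bool"
  for E :: "('a trm \<times> 'a trm) set" where
  ax: "(t, u) \<in> E \<Longrightarrow> derivable E t u"
| refl: "derivable E t t"
| sym: "derivable E t u \<Longrightarrow> derivable E u t"
| trans: "derivable E t u \<Longrightarrow> derivable E u v \<Longrightarrow> derivable E t v"
| inst: "derivable E t u \<Longrightarrow> derivable E (subst \<sigma> t) (subst \<sigma> u)"
| cong_prefix: "derivable E t u \<Longrightarrow> derivable E (Prefix \<alpha> t) (Prefix \<alpha> u)"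
| cong_plus: "derivable E t u \<Longrightarrow> derivable E t' u' \<Longrightarrow> derivable E (Plus t t') (Plus u u')"
| cong_par: "derivable E t u \<Longrightarrow> derivable E t' u' \<Longrightarrow> derivable E (Par t t') (Par u u')"

definition pf_sound :: "('a \<Rightarrow> 'a) \<Rightarrow> ('a trm \<times> 'a trm) set \<Rightarrow> bool" where
  "pf_sound bar E \<longleftrightarrow>
    (\<forall>(t, u) \<in> E. \<forall>\<sigma>. (\<forall>x. process (\<sigma> x)) \<longrightarrow> pf_equiv bar (subst \<sigma> t) (subst \<sigma> u))"

definition pf_ground_complete :: "('a \<Rightarrow> 'a) \<Rightarrow> ('a trm \<times> 'a trm) set \<Rightarrow> bool" where
  "pf_ground_complete bar E \<longleftrightarrow>
    (\<forall>p q. process p \<longrightarrow> process q \<longrightarrow> pf_equiv bar p q \<longrightarrow> derivable E p q)"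

end

(*
  Let p_N be the sum of tau.a^i.tau for i = 1, ..., N. The process a || p_N is equivalent to a sum
  of prefixed processes (its expansion), but equations that are small compared to N cannot remove
  the summand a || p_N. The words tau.a^i.tau must be pairwise prefix-incomparable: for the branches
  tau.a^i, whose trace sets form a chain, the sound equation
    a || (y + tau.z + tau.(z + w)) = a || (y + tau.(z + w)) + tau.(a || z) + a.(y + tau.z + tau.(z + w))
  would split off the branches one at a time.

  The invariant of closed derivations between processes equivalent to a || p_N is the existence of a
  summand equivalent to a || p_N, up to dead parallel components. Only instances of axioms t = u
  matter. If an instance of t under sigma has such a summand and N exceeds the size of t, then some
  variable y, which sigma maps to a process with a tau step, either contributes the whole summand or
  runs in parallel with a live component. Replacing sigma(y) by tau.a^N makes this visible in a
  possible future of t, hence of u, and so y runs in the same way in some summand of u. Under sigma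
  that summand is a live parallel composition with a tau step all of whose futures are futures of
  a || p_N, and this forces it to be equivalent to a || p_N.
*)
theory Submission
  imports Defs
begin

section \<open>Transitions, paths and traces\<close>

inductive_cases step_StopE [elim!]: "step bar Stop \<alpha> p"
inductive_cases step_VarE [elim!]: "step bar (Var x) \<alpha> p"
inductive_cases step_PrefixE [elim!]: "step bar (Prefix \<beta> q) \<alpha> p"
inductive_cases step_PlusE [elim!]: "step bar (Plus q q') \<alpha> p"
inductive_cases path_NilE [elim!]: "path bar p [] q"
inductive_cases path_ConsE [elim!]: "path bar p (\<alpha> # w) q"

lemma step_ParE:
  assumes "step bar (Par p q) \<alpha> r"
  obtains (left) p' where "step bar p \<alpha> p'" and "r = Par p' q"
  | (right) q' where "step bar q \<alpha> q'" and "r = Par p q'"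
  | (sync) a p' q' where "\<alpha> = Tau" and "step bar p (Vis a) p'" and "step bar q (Vis (bar a)) q'"
      and "r = Par p' q'"
  using assms by (cases rule: step.cases) auto

lemma step_Prefix_iff: "step bar (Prefix \<beta> q) \<alpha> p \<longleftrightarrow> \<alpha> = \<beta> \<and> p = q"
  by (auto intro: step.prefix)

lemma step_Plus_iff: "step bar (Plus q q') \<alpha> p \<longleftrightarrow> step bar q \<alpha> p \<or> step bar q' \<alpha> p"
  by (auto intro: step.intros)

lemma path_Nil_iff [simp]: "path bar p [] q \<longleftrightarrow> q = p"
  by (auto intro: path.empty)

lemma path_Cons_iff: "path bar p (\<alpha> # w) q \<longleftrightarrow> (\<exists>p'. step bar p \<alpha> p' \<and> path bar p' w q)"
  by (auto intro: path.cons)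

lemma path_append_iff: "path bar p (v @ w) q \<longleftrightarrow> (\<exists>p'. path bar p v p' \<and> path bar p' w q)"
  by (induction v arbitrary: p) (auto simp: path_Cons_iff)

lemma Nil_in_traces [simp]: "[] \<in> traces bar p"
  unfolding traces_def using path.empty[of bar p] by (intro CollectI exI)

lemma Cons_in_traces_iff: "\<alpha> # w \<in> traces bar p \<longleftrightarrow> (\<exists>p'. step bar p \<alpha> p' \<and> w \<in> traces bar p')"
  unfolding traces_def mem_Collect_eq path_Cons_iff by blast

lemma mem_possible_futures:
  "(w, X) \<in> possible_futures bar p \<longleftrightarrow> (\<exists>p'. path bar p w p' \<and> X = traces bar p')"
  by (auto simp: possible_futures_def)

section \<open>Possible futures after non-empty words\<close>

text \<open>Leaving out the empty word makes futures additive over \<open>Plus\<close>: the entry at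
  the empty word is the trace set of the whole process, which a sum need not share with its
  summands.\<close>

definition futs :: "('a \<Rightarrow> 'a) \<Rightarrow> 'a trm \<Rightarrow> ('a act list \<times> 'a act list set) set" where
  "futs bar p = {(w, X) \<in> possible_futures bar p. w \<noteq> []}"

lemma path_futs: "path bar p w p' \<Longrightarrow> w \<noteq> [] \<Longrightarrow> (w, traces bar p') \<in> futs bar p"
  by (auto simp: futs_def mem_possible_futures)

lemma Cons_in_futs:
  "(\<alpha> # w, X) \<in> futs bar p \<longleftrightarrow> (\<exists>p'. step bar p \<alpha> p' \<and> (w, X) \<in> possible_futures bar p')"
  by (auto simp: futs_def mem_possible_futures path_Cons_iff)

lemma Nil_notin_futs [simp]: "([], X) \<notin> futs bar p"
  by (simp add: futs_def)

lemma possible_futures_eq: "possible_futures bar p = insert ([], traces bar p) (futs bar p)"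
  by (auto simp: futs_def mem_possible_futures)

lemma traces_eq_fst_futs: "traces bar p = insert [] (fst ` futs bar p)"
proof -
  have "traces bar p = fst ` possible_futures bar p"
    unfolding Domain_fst[symmetric] by (auto simp: Domain_iff mem_possible_futures traces_def)
  then show ?thesis by (simp add: possible_futures_eq)
qed

text \<open>The omitted entry at the empty word is the trace set, and this can be read off the first
  components of \<open>futs\<close>.\<close>

lemma pf_equiv_iff_futs: "pf_equiv bar p q \<longleftrightarrow> futs bar p = futs bar q"
proof
  assume "pf_equiv bar p q"
  then show "futs bar p = futs bar q"
    by (simp add: futs_def pf_equiv_def)
next
  assume "futs bar p = futs bar q"
  then show "pf_equiv bar p q"
    by (simp add: pf_equiv_def possible_futures_eq traces_eq_fst_futs)
qed

lemma futs_eqI: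
  assumes "\<And>\<alpha> p'. step bar p \<alpha> p' \<longleftrightarrow> step bar q \<alpha> p'"
  shows "futs bar p = futs bar q"
proof -
  have "(w, X) \<in> futs bar p \<longleftrightarrow> (w, X) \<in> futs bar q" for w X
    by (cases w) (auto simp: Cons_in_futs assms)
  then show ?thesis by auto
qed

lemma futs_Plus: "futs bar (Plus p q) = futs bar p \<union> futs bar q"
proof -
  have "(w, X) \<in> futs bar (Plus p q) \<longleftrightarrow> (w, X) \<in> futs bar p \<union> futs bar q" for w X
    by (cases w) (auto simp: Cons_in_futs intro: step.intros)
  then show ?thesis by auto
qed

lemma pf_equiv_Prefix: "pf_equiv bar p q \<Longrightarrow> pf_equiv bar (Prefix \<alpha> p) (Prefix \<alpha> q)"
proof -
  assume eq: "pf_equiv bar p q"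
  have "(w, X) \<in> futs bar (Prefix \<alpha> p) \<longleftrightarrow> (w, X) \<in> futs bar (Prefix \<alpha> q)" for w X
    using eq by (cases w) (auto simp: Cons_in_futs pf_equiv_def intro: step.prefix)
  then show ?thesis
    by (auto simp: pf_equiv_iff_futs)
qed

section \<open>Synchronising shuffles of words and the futures of parallel compositions\<close>

inductive merge :: "('a \<Rightarrow> 'a) \<Rightarrow> 'a act list \<Rightarrow> 'a act list \<Rightarrow> 'a act list \<Rightarrow> bool"
  for bar :: "'a \<Rightarrow> 'a" where
  merge_Nil: "merge bar [] [] []"
| merge_left: "merge bar u v w \<Longrightarrow> merge bar (\<alpha> # u) v (\<alpha> # w)"
| merge_right: "merge bar u v w \<Longrightarrow> merge bar u (\<alpha> # v) (\<alpha> # w)"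
| merge_sync: "merge bar u v w \<Longrightarrow> merge bar (Vis a # u) (Vis (bar a) # v) (Tau # w)"

lemma merge_Nil_left: "merge bar [] v v"
  by (induction v) (auto intro: merge.intros)

lemma merge_Nil_right: "merge bar v [] v"
  by (induction v) (auto intro: merge.intros)

lemma merge_Nil_leftD: "merge bar u v w \<Longrightarrow> u = [] \<Longrightarrow> w = v"
  by (induction rule: merge.induct) auto

lemma path_ParD:
  "path bar r w r' \<Longrightarrow> r = Par p q \<Longrightarrow>
    \<exists>u v p' q'. merge bar u v w \<and> path bar p u p' \<and> path bar q v q' \<and> r' = Par p' q'"
proof (induction arbitrary: p q rule: path.induct)
  case (empty r)
  then show ?case
    using merge_Nil path.empty by blast
next
  case (cons r \<alpha> r1 w r2)
  from cons.hyps(1) show ?case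
    unfolding cons.prems
  proof (cases rule: step_ParE)
    case (left p1)
    with cons.IH obtain u v p' q' where
      "merge bar u v w" "path bar p1 u p'" "path bar q v q'" "r2 = Par p' q'"
      by blast
    with left show ?thesis
      using merge_left path.cons by blast
  next
    case (right q1)
    with cons.IH obtain u v p' q' where
      "merge bar u v w" "path bar p u p'" "path bar q1 v q'" "r2 = Par p' q'"
      by blast
    with right show ?thesis
      using merge_right path.cons by blast
  next
    case (sync a p1 q1)
    with cons.IH obtain u v p' q' where
      "merge bar u v w" "path bar p1 u p'" "path bar q1 v q'" "r2 = Par p' q'"
      by blast
    then show ?thesis
      using merge_sync[of bar u v w a] path.cons[OF sync(2)] path.cons[OF sync(3)] sync(1) by blast
  qed
qed

lemma path_ParI:
  "merge bar u v w \<Longrightarrow> path bar p u p' \<Longrightarrow> path bar q v q' \<Longrightarrow> path bar (Par p q) w (Par p' q')"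
proof (induction arbitrary: p q rule: merge.induct)
  case (merge_left u v w \<alpha>)
  from merge_left.prems(1) obtain p1 where "step bar p \<alpha> p1" "path bar p1 u p'"
    by blast
  then show ?case
    using path.cons[OF step.par_left merge_left.IH[OF _ merge_left.prems(2)]] by blast
next
  case (merge_right u v w \<alpha>)
  from merge_right.prems(2) obtain q1 where "step bar q \<alpha> q1" "path bar q1 v q'"
    by blast
  then show ?case
    using path.cons[OF step.par_right merge_right.IH[OF merge_right.prems(1)]] by blast
next
  case (merge_sync u v w a)
  from merge_sync.prems obtain p1 q1 where "step bar p (Vis a) p1" "path bar p1 u p'"
    and "step bar q (Vis (bar a)) q1" "path bar q1 v q'"
    by blast
  then show ?case
    using path.cons[OF step.sync merge_sync.IH] by blast
qed auto

definition merge_sets ::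
  "('a \<Rightarrow> 'a) \<Rightarrow> 'a act list set \<Rightarrow> 'a act list set \<Rightarrow> 'a act list set" where
  "merge_sets bar X Y = {w. \<exists>u \<in> X. \<exists>v \<in> Y. merge bar u v w}"

lemma traces_Par: "traces bar (Par p q) = merge_sets bar (traces bar p) (traces bar q)"
  using path_ParD path_ParI unfolding traces_def merge_sets_def by blast

text \<open>Words and trace sets of a composition are determined by those of its components, which
  makes \<open>pf_equiv\<close> a congruence for \<open>Par\<close>.\<close>

lemma possible_futures_Par:
  "(w, Z) \<in> possible_futures bar (Par p q) \<longleftrightarrow>
    (\<exists>u X v Y. (u, X) \<in> possible_futures bar p \<and> (v, Y) \<in> possible_futures bar q
      \<and> merge bar u v w \<and> Z = merge_sets bar X Y)" (is "?L \<longleftrightarrow> ?R")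
proof
  assume ?L
  then obtain r where r: "path bar (Par p q) w r" "Z = traces bar r"
    by (auto simp: mem_possible_futures)
  from path_ParD[OF r(1) HOL.refl] obtain u v p' q' where
    "merge bar u v w" "path bar p u p'" "path bar q v q'" "r = Par p' q'"
    by blast
  then show ?R
    unfolding mem_possible_futures r(2) using traces_Par by blast
next
  assume ?R
  then show ?L
    unfolding mem_possible_futures using traces_Par path_ParI by blast
qed

lemma pf_equiv_Par:
  assumes "pf_equiv bar p p'" and "pf_equiv bar q q'"
  shows "pf_equiv bar (Par p q) (Par p' q')"
  using assms unfolding pf_equiv_def by (auto simp: possible_futures_Par)

lemma traces_Par_left: "traces bar p \<subseteq> traces bar (Par p q)"
  unfolding traces_Par merge_sets_def using merge_Nil_right Nil_in_traces by blast

lemma traces_Par_right: "traces bar q \<subseteq> traces bar (Par p q)"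
  unfolding traces_Par merge_sets_def using merge_Nil_left Nil_in_traces by blast

section \<open>Dead processes as neutral elements of parallel composition\<close>

definition dead :: "('a \<Rightarrow> 'a) \<Rightarrow> 'a trm \<Rightarrow> bool" where
  "dead bar p \<longleftrightarrow> (\<forall>\<alpha> p'. \<not> step bar p \<alpha> p')"

lemma dead_iff_futs: "dead bar p \<longleftrightarrow> futs bar p = {}"
proof
  assume "dead bar p"
  then have "(w, X) \<notin> futs bar p" for w X
    by (cases w) (auto simp: dead_def Cons_in_futs)
  then show "futs bar p = {}" by auto
next
  assume emp: "futs bar p = {}"
  show "dead bar p"
    unfolding dead_def
  proof (intro allI notI)
    fix \<alpha> p' assume "step bar p \<alpha> p'"
    then have "([\<alpha>], traces bar p') \<in> futs bar p"
      by (auto simp: Cons_in_futs possible_futures_eq)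
    then show False using emp by simp
  qed
qed

lemma dead_cong: "pf_equiv bar p q \<Longrightarrow> dead bar p \<longleftrightarrow> dead bar q"
  by (simp add: dead_iff_futs pf_equiv_iff_futs)

lemma possible_futures_dead: "dead bar p \<Longrightarrow> possible_futures bar p = {([], {[]})}"
  by (simp add: dead_iff_futs possible_futures_eq traces_eq_fst_futs)

lemma dead_Stop [simp]: "dead bar Stop"
  by (auto simp: dead_def)

lemma not_dead_Prefix [simp]: "\<not> dead bar (Prefix \<alpha> p)"
  by (auto simp: dead_def intro: step.intros)

lemma dead_Plus [simp]: "dead bar (Plus p q) \<longleftrightarrow> dead bar p \<and> dead bar q"
  by (auto simp: dead_iff_futs futs_Plus)

lemma dead_Par [simp]: "dead bar (Par p q) \<longleftrightarrow> dead bar p \<and> dead bar q"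
  by (auto simp: dead_def elim!: step_ParE intro: step.intros)

lemma merge_sets_Nil_left: "merge_sets bar {[]} Y = Y"
  using merge_Nil_left merge_Nil_leftD by (fastforce simp: merge_sets_def)

lemma pf_equiv_Par_dead_left:
  assumes "dead bar p"
  shows "pf_equiv bar (Par p q) q"
proof -
  have "(w, Z) \<in> possible_futures bar (Par p q) \<longleftrightarrow> (w, Z) \<in> possible_futures bar q" for w Z
    unfolding possible_futures_Par possible_futures_dead[OF assms]
    using merge_Nil_left merge_Nil_leftD by (fastforce simp: merge_sets_Nil_left)
  then show ?thesis by (auto simp: pf_equiv_def)
qed

section \<open>The witnessing family\<close>

definition word_proc :: "'a act list \<Rightarrow> 'a trm" where
  "word_proc w = foldr Prefix w Stop"

lemma word_proc_simps [simp]: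
  "word_proc [] = Stop" "word_proc (\<alpha> # w) = Prefix \<alpha> (word_proc w)"
  by (simp_all add: word_proc_def)

lemma path_word_proc: "path bar (word_proc w) u p \<longleftrightarrow> (\<exists>v. w = u @ v \<and> p = word_proc v)"
proof (induction u arbitrary: w)
  case (Cons \<alpha> u)
  then show ?case
    by (cases w) (auto simp: path_Cons_iff intro: step.prefix)
qed auto

lemma traces_word_proc: "u \<in> traces bar (word_proc w) \<longleftrightarrow> (\<exists>v. w = u @ v)"
  by (auto simp: traces_def path_word_proc)

definition choice :: "'a trm list \<Rightarrow> 'a trm" where
  "choice ts = foldr Plus ts Stop"

lemma step_choice: "step bar (choice ts) \<alpha> p \<longleftrightarrow> (\<exists>t \<in> set ts. step bar t \<alpha> p)"
  by (induction ts) (auto simp: choice_def intro: step.intros)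

text \<open>The leading \<open>Tau\<close> is split off, so this is what remains of a branch after
  its first step. The closing \<open>Tau\<close> makes distinct words prefix-incomparable.\<close>

definition branch :: "'a \<Rightarrow> nat \<Rightarrow> 'a act list" where
  "branch a i = replicate i (Vis a) @ [Tau]"

text \<open>Indices start at 1, so that after its first \<open>Tau\<close> every branch continues
  with \<open>Vis a\<close>.\<close>

definition branches :: "'a \<Rightarrow> nat \<Rightarrow> 'a trm" where
  "branches a N = choice (map (\<lambda>i. word_proc (Tau # branch a i)) [1..<Suc N])"

definition interleaving :: "'a \<Rightarrow> nat \<Rightarrow> 'a trm" where
  "interleaving a N = Par (Prefix (Vis a) Stop) (branches a N)"

text \<open>The component \<open>Stop\<close> is kept so that the derivatives agree syntactically
  with those of \<open>interleaving a N\<close>; equivalence then follows from equality of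
  transitions.\<close>

definition expansion :: "'a \<Rightarrow> nat \<Rightarrow> 'a trm" where
  "expansion a N = Plus (Prefix (Vis a) (Par Stop (branches a N)))
    (choice (map (\<lambda>i. Prefix Tau (Par (Prefix (Vis a) Stop) (word_proc (branch a i)))) [1..<Suc N]))"

lemma step_branches:
  "step bar (branches a N) \<alpha> p \<longleftrightarrow> \<alpha> = Tau \<and> (\<exists>i. 1 \<le> i \<and> i \<le> N \<and> p = word_proc (branch a i))"
  by (auto simp: branches_def step_choice intro!: step.prefix)

lemma step_interleaving:
  "step bar (interleaving a N) \<alpha> p \<longleftrightarrow>
    \<alpha> = Vis a \<and> p = Par Stop (branches a N) \<or>
    \<alpha> = Tau \<and> (\<exists>i. 1 \<le> i \<and> i \<le> N \<and> p = Par (Prefix (Vis a) Stop) (word_proc (branch a i)))"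
  by (auto simp: interleaving_def step_branches elim!: step_ParE intro!: step.intros)

lemma pf_equiv_expansion: "pf_equiv bar (interleaving a N) (expansion a N)"
  unfolding pf_equiv_iff_futs
  by (rule futs_eqI)
    (auto simp: step_interleaving expansion_def step_choice step_Plus_iff step_Prefix_iff
      simp del: upt_Suc)

text \<open>The number of actions before the first \<open>Tau\<close> recovers the index, whatever
  follows.\<close>

lemma branch_prefix: "branch a i @ v = branch a j \<Longrightarrow> i = j"
proof -
  have "takeWhile (\<lambda>x. x \<noteq> Tau) (branch a i @ v) = replicate i (Vis a)" for i :: nat and v
    by (induction i) (auto simp: branch_def)
  from this[of i v] this[of j "[]"] show "branch a i @ v = branch a j \<Longrightarrow> i = j"
    by (metis append_Nil2 length_replicate)
qed

lemma inj_traces_branch: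
  "traces bar (word_proc (branch a i)) = traces bar (word_proc (branch a j)) \<Longrightarrow> i = j"
  by (metis append_Nil2 branch_prefix traces_word_proc)

lemma futs_branches:
  "(w, X) \<in> futs bar (branches a N) \<longleftrightarrow>
    (\<exists>i v. 1 \<le> i \<and> i \<le> N \<and> w \<noteq> [] \<and> Tau # branch a i = w @ v \<and> X = traces bar (word_proc v))"
  by (cases w) (auto simp: Cons_in_futs mem_possible_futures step_branches path_word_proc, blast)

text \<open>Because no word of the family is a prefix of another, the trace set alone forces all
  branches to be present.\<close>

lemma pf_equiv_branchesI:
  assumes sub: "futs bar q \<subseteq> futs bar (branches a N)"
    and tr: "traces bar (branches a N) \<subseteq> traces bar q"
  shows "pf_equiv bar q (branches a N)"
proof -
  have "(w, X) \<in> futs bar q" if wX: "(w, X) \<in> futs bar (branches a N)" for w X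
  proof -
    obtain i v where i: "1 \<le> i" "i \<le> N" "w \<noteq> []" "Tau # branch a i = w @ v"
      and X: "X = traces bar (word_proc v)"
      using wX unfolding futs_branches by blast
    \<comment> \<open>The completed word \<open>w @ v\<close> is a trace of \<open>q\<close>;
      splitting it after \<open>w\<close> yields a derivative that can still perform
      \<open>v\<close>.\<close>
    have "(w @ v, {[]}) \<in> futs bar (branches a N)"
      unfolding futs_branches using i traces_word_proc[of _ bar "[]"]
      by (intro exI[of _ i] exI[of _ "[]"]) auto
    then have "w @ v \<in> traces bar q"
      using tr by (force simp: traces_eq_fst_futs)
    then obtain q' where q': "path bar q w q'" "v \<in> traces bar q'"
      unfolding traces_def mem_Collect_eq path_append_iff by blast
    then have wq: "(w, traces bar q') \<in> futs bar q"
      using i(3) by (intro path_futs)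
    then obtain j v' where j: "Tau # branch a j = w @ v'" "traces bar q' = traces bar (word_proc v')"
      using subsetD[OF sub wq] unfolding futs_branches by blast
    then obtain v'' where "v' = v @ v''"
      using q'(2) by (auto simp: traces_word_proc)
    \<comment> \<open>Incomparability excludes a proper continuation beyond
      \<open>v\<close>.\<close>
    then have "branch a j = branch a i @ v''"
      using i(4) j(1) by (metis append_Cons append_assoc list.inject)
    then have "j = i" by (metis branch_prefix)
    then have "v' = v" using i(4) j(1) by simp
    then show ?thesis using wq j(2) X by simp
  qed
  then show ?thesis using sub by (auto simp: pf_equiv_iff_futs)
qed

section \<open>Decomposing a parallel composition\<close>

locale complementation =
  fixes bar :: "'a \<Rightarrow> 'a"
  assumes bar_bar: "bar (bar a) = a"
    and bar_neq: "bar a \<noteq> a"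
begin

lemma merge_commute: "merge bar u v w \<Longrightarrow> merge bar v u w"
proof (induction rule: merge.induct)
  case (merge_sync u v w a)
  then show ?case using merge.merge_sync[of bar v u w "bar a"] by (simp add: bar_bar)
qed (auto intro: merge.intros)

lemma merge_sets_commute: "merge_sets bar X Y = merge_sets bar Y X"
  unfolding merge_sets_def using merge_commute by blast

lemma pf_equiv_Par_commute: "pf_equiv bar (Par p q) (Par q p)"
proof -
  have "(w, Z) \<in> possible_futures bar (Par q p)" if "(w, Z) \<in> possible_futures bar (Par p q)" for p q w Z
    using that unfolding possible_futures_Par using merge_commute merge_sets_commute by blast
  then show ?thesis unfolding pf_equiv_def by auto
qed

lemma pf_equiv_Par_dead_right: "dead bar q \<Longrightarrow> pf_equiv bar (Par p q) p"
  using pf_equiv_Par_commute pf_equiv_Par_dead_left by (metis pf_equiv_def)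

text \<open>After \<open>Tau\<close> both components offer only \<open>Vis a\<close>, and they
  cannot synchronise because \<open>bar a \<noteq> a\<close>.\<close>

lemma futs_interleaving_Tau:
  assumes "([Tau], traces bar r) \<in> futs bar (interleaving a N)" and "step bar r \<alpha> r'"
  shows "\<alpha> = Vis a"
proof -
  obtain i where i: "1 \<le> i" "traces bar r = traces bar (Par (Prefix (Vis a) Stop) (word_proc (branch a i)))"
    using assms(1) by (auto simp: Cons_in_futs mem_possible_futures step_interleaving)
  have "[\<alpha>] \<in> traces bar r"
    using assms(2) by (auto simp: Cons_in_traces_iff)
  then obtain s where "step bar (Par (Prefix (Vis a) Stop) (word_proc (branch a i))) \<alpha> s"
    unfolding i by (auto simp: Cons_in_traces_iff)
  moreover obtain k where "i = Suc k" using i(1) by (cases i) auto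
  ultimately show ?thesis
    using bar_neq[of a] by (auto simp: branch_def elim!: step_ParE)
qed

lemma futs_interleaving_Vis:
  "(Vis a # w, X) \<in> futs bar (interleaving a N) \<longleftrightarrow> (w, X) \<in> possible_futures bar (branches a N)"
  using pf_equiv_Par_dead_left[OF dead_Stop]
  by (auto simp: Cons_in_futs step_interleaving pf_equiv_def)

text \<open>After the \<open>Tau\<close> of \<open>q\<close> only \<open>Vis a\<close> is enabled,
  which restricts the initial actions of \<open>p\<close>; running \<open>p\<close> first exposes
  \<open>q\<close>. Inclusion of futures suffices as hypothesis, which is what a summand of an
  equivalent process provides.\<close>

lemma Par_in_interleaving:
  assumes sub: "futs bar (Par p q) \<subseteq> futs bar (interleaving a N)"
    and live: "\<not> dead bar p"
    and tau: "step bar q Tau q'"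
  shows "pf_equiv bar p (Prefix (Vis a) Stop)" and "pf_equiv bar q (branches a N)"
proof -
  have step_fut: "([\<alpha>], traces bar r) \<in> futs bar (interleaving a N)"
    if "step bar (Par p q) \<alpha> r" for \<alpha> r
  proof -
    have "([\<alpha>], traces bar r) \<in> futs bar (Par p q)"
      using that by (auto simp: Cons_in_futs possible_futures_eq)
    then show ?thesis using sub by blast
  qed
  have p_init: "\<alpha> = Vis a" if "step bar p \<alpha> p'" for \<alpha> p'
    using futs_interleaving_Tau[OF step_fut[OF step.par_right[OF tau]] step.par_left[OF that]] .
  have p_dead: "dead bar p'" if st: "step bar p (Vis a) p'" for p'
    unfolding dead_def
  proof (intro allI notI)
    fix \<alpha> p'' assume st': "step bar p' \<alpha> p''"
    \<comment> \<open>The derivative after \<open>Vis a\<close> must have the trace set of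
      \<open>branches a N\<close>, so anything \<open>p'\<close> offers is
      \<open>Tau\<close>.\<close>
    have "([], traces bar (Par p' q)) \<in> possible_futures bar (branches a N)"
      using step_fut[OF step.par_left[OF st]] by (simp add: futs_interleaving_Vis)
    then have "traces bar (Par p' q) = traces bar (branches a N)"
      by (simp add: mem_possible_futures)
    moreover have "[\<alpha>] \<in> traces bar (Par p' q)"
      using step.par_left[OF st'] by (auto simp: Cons_in_traces_iff)
    ultimately have "\<alpha> = Tau"
      by (auto simp: Cons_in_traces_iff step_branches)
    \<comment> \<open>If \<open>q\<close> moves first, \<open>p'\<close> still offers
      \<open>\<alpha>\<close>, but in the middle of a branch only \<open>Vis a\<close> is
      possible.\<close>
    have "path bar (Par p q) [Vis a, Tau] (Par p' q')"
      using step.par_left[OF st] step.par_right[OF tau] by (auto simp: path_Cons_iff)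
    then have "([Vis a, Tau], traces bar (Par p' q')) \<in> futs bar (Par p q)"
      by (rule path_futs) simp
    then have "([Vis a, Tau], traces bar (Par p' q')) \<in> futs bar (interleaving a N)"
      using sub by blast
    then have "([Tau], traces bar (Par p' q')) \<in> possible_futures bar (branches a N)"
      by (simp add: futs_interleaving_Vis)
    then obtain i where i: "1 \<le> i" "traces bar (Par p' q') = traces bar (word_proc (branch a i))"
      by (auto simp: mem_possible_futures path_Cons_iff step_branches)
    have "[\<alpha>] \<in> traces bar (Par p' q')"
      using step.par_left[OF st'] by (auto simp: Cons_in_traces_iff)
    then have "\<alpha> = Vis a"
      unfolding i(2) traces_word_proc using i(1) by (cases i) (auto simp: branch_def)
    then show False using \<open>\<alpha> = Tau\<close> by simp
  qed
  obtain p' where p': "step bar p (Vis a) p'"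
    using live p_init by (auto simp: dead_def)
  have "(\<beta> # w, X) \<in> futs bar p \<longleftrightarrow> \<beta> = Vis a \<and> (w, X) \<in> {([], {[]})}" for \<beta> w X
  proof
    assume "(\<beta> # w, X) \<in> futs bar p"
    then obtain r where r: "step bar p \<beta> r" "(w, X) \<in> possible_futures bar r"
      unfolding Cons_in_futs by blast
    have "\<beta> = Vis a" by (rule p_init[OF r(1)])
    then show "\<beta> = Vis a \<and> (w, X) \<in> {([], {[]})}"
      using r possible_futures_dead[OF p_dead] by simp
  next
    assume "\<beta> = Vis a \<and> (w, X) \<in> {([], {[]})}"
    then show "(\<beta> # w, X) \<in> futs bar p"
      unfolding Cons_in_futs using p' possible_futures_dead[OF p_dead[OF p']] by blast
  qed
  moreover have "(\<beta> # w, X) \<in> futs bar (Prefix (Vis a) Stop) \<longleftrightarrow>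
      \<beta> = Vis a \<and> (w, X) \<in> {([], {[]})}" for \<beta> w X
    by (simp add: Cons_in_futs step_Prefix_iff possible_futures_dead)
  ultimately have "(w, X) \<in> futs bar p \<longleftrightarrow> (w, X) \<in> futs bar (Prefix (Vis a) Stop)" for w X
    by (cases w) simp_all
  then show "pf_equiv bar p (Prefix (Vis a) Stop)"
    unfolding pf_equiv_iff_futs by (intro set_eqI) (simp add: split_paired_all)
  have q_sub: "(w, X) \<in> possible_futures bar (branches a N)" if wX: "(w, X) \<in> possible_futures bar q" for w X
  proof -
    have "(w, X) \<in> possible_futures bar (Par p' q)"
      using wX pf_equiv_Par_dead_left[OF p_dead[OF p']] by (simp add: pf_equiv_def)
    then have "(Vis a # w, X) \<in> futs bar (Par p q)"
      using step.par_left[OF p'] by (auto simp: Cons_in_futs)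
    then show ?thesis using sub futs_interleaving_Vis by blast
  qed
  show "pf_equiv bar q (branches a N)"
  proof (rule pf_equiv_branchesI)
    show "futs bar q \<subseteq> futs bar (branches a N)"
      using q_sub by (auto simp: futs_def)
    \<comment> \<open>At the empty word \<open>q_sub\<close> gives equality of the trace
      sets.\<close>
    show "traces bar (branches a N) \<subseteq> traces bar q"
      using q_sub[of "[]" "traces bar q"] by (auto simp: mem_possible_futures)
  qed
qed

lemma Par_pf_equiv_interleaving:
  assumes sub: "futs bar (Par p q) \<subseteq> futs bar (interleaving a N)"
    and live: "\<not> dead bar p" "\<not> dead bar q"
    and tau: "step bar p Tau p' \<or> step bar q Tau p'"
  shows "pf_equiv bar (Par p q) (interleaving a N)"
  using tau
proof
  assume "step bar q Tau p'"
  from Par_in_interleaving[OF sub live(1) this] show ?thesis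
    unfolding interleaving_def by (rule pf_equiv_Par)
next
  assume st: "step bar p Tau p'"
  have eq: "pf_equiv bar (Par p q) (Par q p)" by (rule pf_equiv_Par_commute)
  then have "futs bar (Par q p) \<subseteq> futs bar (interleaving a N)"
    using sub by (simp add: pf_equiv_iff_futs)
  from Par_in_interleaving[OF this live(2) st] have "pf_equiv bar (Par q p) (interleaving a N)"
    unfolding interleaving_def by (rule pf_equiv_Par)
  with eq show ?thesis by (simp add: pf_equiv_def)
qed

end

section \<open>Summands equivalent to a given process\<close>

text \<open>Dead parallel components are skipped, so that the notion is invariant under laws such as
  \<open>x \<parallel> 0 \<approx> x\<close>.\<close>

fun has_summand :: "('a \<Rightarrow> 'a) \<Rightarrow> 'a trm \<Rightarrow> 'a trm \<Rightarrow> bool" where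
  "has_summand bar r (Plus p q) \<longleftrightarrow> has_summand bar r p \<or> has_summand bar r q"
| "has_summand bar r (Par p q) \<longleftrightarrow>
    (if dead bar p then has_summand bar r q
     else if dead bar q then has_summand bar r p
     else pf_equiv bar (Par p q) r)"
| "has_summand bar r Stop \<longleftrightarrow> False"
| "has_summand bar r (Var x) \<longleftrightarrow> False"
| "has_summand bar r (Prefix \<alpha> p) \<longleftrightarrow> False"

text \<open>Variables and prefixes each count once. This bounds both the number of
  \<open>Tau\<close> futures stemming from prefixes and the length of \<open>Vis a\<close> blocks
  when variables are replaced by short processes.\<close>

fun weight :: "'a trm \<Rightarrow> nat" where
  "weight Stop = 0"
| "weight (Var x) = 1"
| "weight (Prefix \<alpha> t) = Suc (weight t)"
| "weight (Plus t u) = weight t + weight u"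
| "weight (Par t u) = weight t + weight u"

text \<open>Unguarded occurrence: the substitute of such a variable can act at once.\<close>

fun active :: "nat \<Rightarrow> 'a trm \<Rightarrow> bool" where
  "active y Stop \<longleftrightarrow> False"
| "active y (Var x) \<longleftrightarrow> x = y"
| "active y (Prefix \<alpha> t) \<longleftrightarrow> False"
| "active y (Plus t u) \<longleftrightarrow> active y t \<or> active y u"
| "active y (Par t u) \<longleftrightarrow> active y t \<or> active y u"

text \<open>Parallel components beside the variable stay in place and can only enlarge the trace
  set, hence an inclusion.\<close>

lemma active_step:
  assumes "active y t" and "step bar (\<sigma> y) \<alpha> p"
  shows "\<exists>q. step bar (subst \<sigma> t) \<alpha> q \<and> traces bar p \<subseteq> traces bar q"
  using assms
proof (induction t)
  case (Par t u)
  have sub: "traces bar q \<subseteq> traces bar (Par q r)" "traces bar q \<subseteq> traces bar (Par r q)" for q r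
    using traces_Par_left traces_Par_right by blast+
  from Par.prems(1) consider "active y t" | "active y u" by auto
  then show ?case
  proof cases
    case 1
    with Par obtain q where "step bar (subst \<sigma> t) \<alpha> q" "traces bar p \<subseteq> traces bar q" by blast
    then show ?thesis using sub(1) step.par_left by fastforce
  next
    case 2
    with Par obtain q where "step bar (subst \<sigma> u) \<alpha> q" "traces bar p \<subseteq> traces bar q" by blast
    then show ?thesis using sub(2) step.par_right by fastforce
  qed
qed (auto intro: step.intros)

text \<open>If a \<open>Tau\<close> step of a term instantiated this way enables \<open>replicate N (Vis a)\<close>, where
  \<open>N\<close> exceeds the weight of the term, then the step comes from the substitute of \<open>y\<close>: only
  after the \<open>Tau\<close> of that substitute are many \<open>Vis a\<close> steps available.\<close>

definition test_subst :: "('a \<Rightarrow> 'a) \<Rightarrow> 'a \<Rightarrow> nat \<Rightarrow> (nat \<Rightarrow> 'a trm) \<Rightarrow> nat \<Rightarrow> nat \<Rightarrow> 'a trm" where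
  "test_subst bar a N \<sigma> y z =
    (if z = y then word_proc (Tau # replicate N (Vis a))
     else if dead bar (\<sigma> z) then Stop
     else Prefix (Vis a) Stop)"

section \<open>Instances under the test substitution\<close>

lemma process_word_proc: "process (word_proc w)"
  by (induction w) (auto simp: process_def)

lemma process_test_subst: "process (test_subst bar a N \<sigma> y z)"
  using process_word_proc[of "Tau # replicate N (Vis a)"] by (auto simp: test_subst_def process_def)

lemma dead_subst_cong:
  "(\<And>z. dead bar (\<sigma> z) \<longleftrightarrow> dead bar (\<rho> z)) \<Longrightarrow> dead bar (subst \<sigma> t) \<longleftrightarrow> dead bar (subst \<rho> t)"
  by (induction t) auto

text \<open>Dead substitutes become \<open>Stop\<close> and live ones stay live; \<open>y\<close>
  must be live under \<open>\<sigma>\<close> because its new substitute is.\<close>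

lemma dead_test_subst:
  assumes "\<not> dead bar (\<sigma> y)"
  shows "dead bar (subst (test_subst bar a N \<sigma> y) t) \<longleftrightarrow> dead bar (subst \<sigma> t)"
  by (rule dead_subst_cong) (use assms in \<open>auto simp: test_subst_def\<close>)

text \<open>An upper bound on the number of \<open>Vis a\<close> steps available before any other
  action. Adding up in the \<open>Plus\<close> clause is coarse but matches
  \<open>weight\<close>.\<close>

fun depth_before_tau :: "'a \<Rightarrow> 'a trm \<Rightarrow> nat" where
  "depth_before_tau a Stop = 0"
| "depth_before_tau a (Var x) = 0"
| "depth_before_tau a (Prefix \<alpha> t) = (if \<alpha> = Vis a then Suc (depth_before_tau a t) else 0)"
| "depth_before_tau a (Plus t u) = depth_before_tau a t + depth_before_tau a u"
| "depth_before_tau a (Par t u) = depth_before_tau a t + depth_before_tau a u"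

lemma step_depth_before_tau:
  "step bar p \<alpha> q \<Longrightarrow> \<alpha> = Vis a \<Longrightarrow> Suc (depth_before_tau a q) \<le> depth_before_tau a p"
  by (induction rule: step.induct) auto

lemma replicate_in_traces_le:
  "replicate k (Vis a) \<in> traces bar p \<Longrightarrow> k \<le> depth_before_tau a p"
proof (induction k arbitrary: p)
  case (Suc k)
  then obtain q where "step bar p (Vis a) q" "k \<le> depth_before_tau a q"
    by (auto simp: Cons_in_traces_iff)
  then show ?case using step_depth_before_tau[of bar p "Vis a" q a] by simp
qed simp

text \<open>The substitute of \<open>y\<close> starts with \<open>Tau\<close> and contributes 0;
  every other substitute contributes at most 1.\<close>

lemma depth_before_tau_test_subst:
  "depth_before_tau a (subst (test_subst bar a N \<sigma> y) t) \<le> weight t"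
  by (induction t) (auto simp: test_subst_def)

text \<open>If \<open>y\<close> is guarded, one step can at most uncover it, so its long block is
  still hidden behind a \<open>Tau\<close>.\<close>

lemma depth_before_tau_step_test_subst:
  assumes "step bar (subst (test_subst bar a N \<sigma> y) t) \<alpha> p" and "\<not> active y t"
  shows "depth_before_tau a p \<le> weight t"
  using assms
proof (induction t arbitrary: \<alpha> p)
  case (Var x)
  then show ?case by (auto simp: test_subst_def split: if_splits)
next
  case (Prefix \<beta> t)
  then show ?case
    using depth_before_tau_test_subst[of a bar N \<sigma> y t] by auto
next
  case (Plus t u)
  then show ?case
    by (auto intro: trans_le_add1 trans_le_add2)
next
  case (Par t u)
  have le: "depth_before_tau a (subst (test_subst bar a N \<sigma> y) t) \<le> weight t"
    "depth_before_tau a (subst (test_subst bar a N \<sigma> y) u) \<le> weight u"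
    by (rule depth_before_tau_test_subst)+
  from Par.prems(1)[simplified] show ?case
  proof (cases rule: step_ParE)
    case (left p')
    then show ?thesis using Par.IH(1)[of \<alpha> p'] Par.prems(2) le by auto
  next
    case (right p')
    then show ?thesis using Par.IH(2)[of \<alpha> p'] Par.prems(2) le by auto
  next
    case (sync b p' q')
    then show ?thesis
      using Par.IH(1)[of "Vis b" p'] Par.IH(2)[of "Vis (bar b)" q'] Par.prems(2) by auto
  qed
qed auto

text \<open>With only \<open>Tau\<close> steps initially there is no synchronisation, and the active
  variables contribute no \<open>Tau\<close>; every \<open>Tau\<close> future therefore stems from a
  prefix of \<open>t\<close>.\<close>

lemma card_Tau_futures:
  assumes "\<And>\<alpha> p. step bar (subst \<sigma> t) \<alpha> p \<Longrightarrow> \<alpha> = Tau"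
    and "\<And>y p. active y t \<Longrightarrow> \<not> step bar (\<sigma> y) Tau p"
  shows "finite {traces bar p |p. step bar (subst \<sigma> t) Tau p} \<and>
    card {traces bar p |p. step bar (subst \<sigma> t) Tau p} \<le> weight t"
  using assms
proof (induction t)
  case Stop
  have "{traces bar p |p. step bar (subst \<sigma> Stop) Tau p} = {}" by auto
  then show ?case by simp
next
  case (Var x)
  then have "{traces bar p |p. step bar (subst \<sigma> (Var x)) Tau p} = {}" by auto
  then show ?case by simp
next
  case (Prefix \<alpha> t)
  have "{traces bar p |p. step bar (subst \<sigma> (Prefix \<alpha> t)) Tau p} \<subseteq> {traces bar (subst \<sigma> t)}"
    by auto
  from finite_subset[OF this] card_mono[OF _ this] show ?case by simp
next
  case (Plus t u)
  have "{traces bar p |p. step bar (subst \<sigma> (Plus t u)) Tau p} =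
      {traces bar p |p. step bar (subst \<sigma> t) Tau p} \<union> {traces bar p |p. step bar (subst \<sigma> u) Tau p}"
    by (auto simp: step_Plus_iff)
  moreover have "finite {traces bar p |p. step bar (subst \<sigma> t) Tau p} \<and>
      card {traces bar p |p. step bar (subst \<sigma> t) Tau p} \<le> weight t"
    by (rule Plus.IH(1)) (use Plus.prems in \<open>auto simp: step_Plus_iff\<close>)
  moreover have "finite {traces bar p |p. step bar (subst \<sigma> u) Tau p} \<and>
      card {traces bar p |p. step bar (subst \<sigma> u) Tau p} \<le> weight u"
    by (rule Plus.IH(2)) (use Plus.prems in \<open>auto simp: step_Plus_iff\<close>)
  ultimately show ?case
    using card_Un_le[of "{traces bar p |p. step bar (subst \<sigma> t) Tau p}"
        "{traces bar p |p. step bar (subst \<sigma> u) Tau p}"]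
    by auto
next
  case (Par t u)
  let ?A = "{traces bar p |p. step bar (subst \<sigma> t) Tau p}"
  let ?B = "{traces bar p |p. step bar (subst \<sigma> u) Tau p}"
  \<comment> \<open>The component that does not move has a fixed trace set, so merging with it maps
    futures to futures and cannot increase their number.\<close>
  let ?f = "\<lambda>X. merge_sets bar X (traces bar (subst \<sigma> u))"
  let ?g = "\<lambda>X. merge_sets bar (traces bar (subst \<sigma> t)) X"
  have A: "finite ?A \<and> card ?A \<le> weight t"
    by (rule Par.IH(1)) (use Par.prems step.par_left in \<open>fastforce+\<close>)
  have B: "finite ?B \<and> card ?B \<le> weight u"
    by (rule Par.IH(2)) (use Par.prems step.par_right in \<open>fastforce+\<close>)
  have "{traces bar p |p. step bar (subst \<sigma> (Par t u)) Tau p} \<subseteq> ?f ` ?A \<union> ?g ` ?B"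
  proof
    fix X assume "X \<in> {traces bar p |p. step bar (subst \<sigma> (Par t u)) Tau p}"
    then obtain p where X: "X = traces bar p"
      and st: "step bar (Par (subst \<sigma> t) (subst \<sigma> u)) Tau p"
      by auto
    from st show "X \<in> ?f ` ?A \<union> ?g ` ?B"
    proof (cases rule: step_ParE)
      case (sync b p' q')
      from Par.prems(1)[of "Vis b"] step.par_left[OF sync(2)] have False by auto
      then show ?thesis ..
    qed (auto simp: X traces_Par)
  qed
  moreover have "finite (?f ` ?A \<union> ?g ` ?B)" using A B by simp
  moreover have "card (?f ` ?A \<union> ?g ` ?B) \<le> weight t + weight u"
    using card_Un_le[of "?f ` ?A" "?g ` ?B"] card_image_le[of ?A ?f] card_image_le[of ?B ?g] A B
    by linarith
  ultimately show ?case
    using card_mono finite_subset by (metis (no_types, lifting) le_trans weight.simps(5))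
qed

section \<open>Closed terms and the summands of the expansion\<close>

lemma subst_subst: "subst \<sigma> (subst \<rho> t) = subst (subst \<sigma> \<circ> \<rho>) t"
  by (induction t) auto

lemma process_subst: "\<forall>x. process (\<sigma> x) \<Longrightarrow> process (subst \<sigma> t)"
  by (induction t) (auto simp: process_def)

lemma subst_process:
  assumes "process t"
  shows "subst \<sigma> t = t"
proof -
  have "vars t = {} \<Longrightarrow> subst \<sigma> t = t" by (induction t) auto
  then show ?thesis using assms by (simp add: process_def)
qed

lemma process_simps [simp]:
  "process Stop" "process (Prefix \<alpha> t) \<longleftrightarrow> process t"
  "process (Plus t u) \<longleftrightarrow> process t \<and> process u" "process (Par t u) \<longleftrightarrow> process t \<and> process u"
  by (auto simp: process_def)

lemma process_choice: "process (choice ts) \<longleftrightarrow> (\<forall>t \<in> set ts. process t)"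
  by (induction ts) (auto simp: choice_def process_def)

lemma process_branches: "process (branches a N)"
  using process_word_proc[of "Tau # branch a _"]
  by (auto simp: branches_def process_choice simp del: word_proc_simps upt_Suc)

lemma process_interleaving: "process (interleaving a N)"
  using process_branches by (simp add: interleaving_def process_def)

lemma process_expansion: "process (expansion a N)"
  using process_word_proc[of "branch a _"] process_branches
  by (auto simp: expansion_def process_choice simp del: upt_Suc)

lemma has_summand_choice: "has_summand bar r (choice ts) \<longleftrightarrow> (\<exists>t \<in> set ts. has_summand bar r t)"
  by (induction ts) (auto simp: choice_def)

lemma not_has_summand_expansion: "\<not> has_summand bar r (expansion a N)"
  by (auto simp: expansion_def has_summand_choice)

section \<open>Small terms observed through the test substitution\<close>

context complementation
begin

lemma futs_subset_if_has_summand: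
  assumes "has_summand bar r p"
  shows "futs bar r \<subseteq> futs bar p"
  using assms(1)
proof (induction p)
  case (Par p q)
  show ?case
    using Par pf_equiv_Par_dead_left[of bar p q] pf_equiv_Par_dead_right[of q p]
    by (auto simp: pf_equiv_iff_futs split: if_splits)
qed (auto simp: futs_Plus)

text \<open>Pigeonhole: the \<open>N\<close> branches have \<open>N\<close> distinct trace sets,
  more than the prefixes of a small term can provide.\<close>

lemma Tau_future_of_active_variable:
  assumes eq: "pf_equiv bar (subst \<sigma> t) (branches a N)" and small: "weight t < N"
  obtains y p where "active y t" and "step bar (\<sigma> y) Tau p"
proof (rule ccontr)
  assume neg: "\<not> thesis"
  have fut: "futs bar (subst \<sigma> t) = futs bar (branches a N)"
    using eq by (simp add: pf_equiv_iff_futs)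
  let ?F = "{traces bar p |p. step bar (subst \<sigma> t) Tau p}"
  have init: "\<alpha> = Tau" if "step bar (subst \<sigma> t) \<alpha> p" for \<alpha> p
  proof -
    have "([\<alpha>], traces bar p) \<in> futs bar (branches a N)"
      unfolding fut[symmetric] using that by (auto simp: Cons_in_futs possible_futures_eq)
    then show ?thesis by (auto simp: futs_branches)
  qed
  have "finite ?F \<and> card ?F \<le> weight t"
    by (rule card_Tau_futures) (use init neg that in blast)+
  then have F: "finite ?F" "card ?F \<le> weight t"
    by auto
  have sub: "(\<lambda>i. traces bar (word_proc (branch a i))) ` {1..N} \<subseteq> ?F"
  proof clarify
    fix i assume "i \<in> {1..N}"
    then have "([Tau], traces bar (word_proc (branch a i))) \<in> futs bar (branches a N)"
      by (auto simp: futs_branches)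
    then show "\<exists>p. traces bar (word_proc (branch a i)) = traces bar p \<and> step bar (subst \<sigma> t) Tau p"
      unfolding fut[symmetric] by (auto simp: Cons_in_futs mem_possible_futures)
  qed
  have "inj_on (\<lambda>i. traces bar (word_proc (branch a i))) {1..N}"
    by (auto intro!: inj_onI dest: inj_traces_branch)
  then have "N = card ((\<lambda>i. traces bar (word_proc (branch a i))) ` {1..N})"
    by (simp add: card_image)
  also have "\<dots> \<le> card ?F" using card_mono[OF F(1) sub] .
  finally show False using F(2) small by simp
qed

text \<open>The \<open>Tau\<close> is not a synchronisation: all initial visible actions are
  \<open>Vis a\<close>, and \<open>a\<close> is not its own complement.\<close>

lemma interleaving_Tau_step:
  assumes eq: "pf_equiv bar (Par p q) (interleaving a N)" and "N \<ge> 1"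
  shows "(\<exists>p'. step bar p Tau p') \<or> (\<exists>q'. step bar q Tau q')"
proof -
  have fut: "futs bar (Par p q) = futs bar (interleaving a N)"
    using eq by (simp add: pf_equiv_iff_futs)
  have init: "\<alpha> \<in> {Vis a, Tau}" if "step bar (Par p q) \<alpha> r" for \<alpha> r
  proof -
    have "([\<alpha>], traces bar r) \<in> futs bar (interleaving a N)"
      unfolding fut[symmetric] using that by (auto simp: Cons_in_futs possible_futures_eq)
    then show ?thesis by (auto simp: Cons_in_futs step_interleaving)
  qed
  have "step bar (interleaving a N) Tau (Par (Prefix (Vis a) Stop) (word_proc (branch a 1)))"
    using \<open>N \<ge> 1\<close> by (auto simp: step_interleaving)
  then have "\<exists>X. ([Tau], X) \<in> futs bar (Par p q)"
    unfolding fut by (auto simp: Cons_in_futs possible_futures_eq)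
  then obtain r where "step bar (Par p q) Tau r"
    by (auto simp: Cons_in_futs)
  then show ?thesis
  proof (cases rule: step_ParE)
    case (sync b p' q')
    then have "b = a" "bar b = a"
      using init[OF step.par_left[OF sync(2)]] init[OF step.par_right[OF sync(3)]] by auto
    then show ?thesis using bar_neq[of a] by simp
  qed blast+
qed

lemma test_subst_step:
  assumes "active y t"
  obtains p where "step bar (subst (test_subst bar a N \<sigma> y) t) Tau p"
    and "replicate N (Vis a) \<in> traces bar p"
proof -
  have "step bar (test_subst bar a N \<sigma> y y) Tau (word_proc (replicate N (Vis a)))"
    by (simp add: test_subst_def step_Prefix_iff)
  from active_step[OF assms, of bar "test_subst bar a N \<sigma> y", OF this] show ?thesis
    using that traces_word_proc[of "replicate N (Vis a)" bar "replicate N (Vis a)"] by auto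
qed

text \<open>The trace through \<open>Par\<close> is one action longer than \<open>replicate N (Vis a)\<close>; this is how a
  live parallel component next to the variable \<open>y\<close> is observed.\<close>

lemma test_step_of_Par:
  assumes eq: "pf_equiv bar (subst \<sigma> (Par t u)) (interleaving a N)"
    and live: "\<not> dead bar (subst \<sigma> t)"
    and small: "weight u < N"
    and tau: "step bar (subst \<sigma> u) Tau q"
  shows "\<exists>y p s. step bar (\<sigma> y) Tau s \<and> step bar (subst (test_subst bar a N \<sigma> y) (Par t u)) Tau p \<and>
    replicate N (Vis a) \<in> traces bar p \<and>
    \<not> traces bar p \<subseteq> traces bar (word_proc (replicate N (Vis a)))"
proof -
  have "futs bar (Par (subst \<sigma> t) (subst \<sigma> u)) \<subseteq> futs bar (interleaving a N)"
    using eq by (simp add: pf_equiv_iff_futs)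
  \<comment> \<open>The decomposition identifies \<open>subst \<sigma> u\<close> with
    \<open>branches a N\<close> up to equivalence, so the counting argument applies to
    \<open>u\<close>.\<close>
  from Par_in_interleaving(2)[OF this live tau] obtain y s where
    y: "active y u" "step bar (\<sigma> y) Tau s"
    using Tau_future_of_active_variable small by blast
  let ?\<rho> = "test_subst bar a N \<sigma> y"
  obtain p where p: "step bar (subst ?\<rho> u) Tau p" "replicate N (Vis a) \<in> traces bar p"
    using test_subst_step[OF y(1)] by blast
  have "\<not> dead bar (\<sigma> y)" using y(2) by (auto simp: dead_def)
  then have "\<not> dead bar (subst ?\<rho> t)" using live by (simp add: dead_test_subst)
  then obtain \<alpha> t' where t': "step bar (subst ?\<rho> t) \<alpha> t'" by (auto simp: dead_def)
  have "\<alpha> # replicate N (Vis a) \<in> traces bar (Par (subst ?\<rho> t) p)"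
    using step.par_left[OF t'] traces_Par_right p(2) by (fastforce simp: Cons_in_traces_iff)
  moreover have "\<alpha> # replicate N (Vis a) \<notin> traces bar (word_proc (replicate N (Vis a)))"
    by (auto simp: traces_word_proc dest: arg_cong[of _ _ length])
  ultimately have "\<not> traces bar (Par (subst ?\<rho> t) p) \<subseteq> traces bar (word_proc (replicate N (Vis a)))"
    by blast
  moreover have "replicate N (Vis a) \<in> traces bar (Par (subst ?\<rho> t) p)"
    using traces_Par_right p(2) by blast
  moreover have "step bar (subst ?\<rho> (Par t u)) Tau (Par (subst ?\<rho> t) p)"
    using p(1) by (auto intro: step.par_right)
  ultimately show ?thesis using y(2) by blast
qed

text \<open>Forward half of the transfer: either \<open>y\<close> itself supplies the summand, or it
  runs beside a live component, which shows as a trace that the substitute of \<open>y\<close> alone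
  does not have.\<close>

lemma has_summand_imp_test_step:
  assumes "has_summand bar (interleaving a N) (subst \<sigma> t)" and "weight t < N"
  shows "\<exists>y p s. step bar (\<sigma> y) Tau s \<and> step bar (subst (test_subst bar a N \<sigma> y) t) Tau p \<and>
    replicate N (Vis a) \<in> traces bar p \<and>
    (has_summand bar (interleaving a N) (\<sigma> y) \<or>
      \<not> traces bar p \<subseteq> traces bar (word_proc (replicate N (Vis a))))"
  using assms
proof (induction t)
  case (Var y)
  then have "futs bar (interleaving a N) \<subseteq> futs bar (\<sigma> y)"
    using futs_subset_if_has_summand by simp
  \<comment> \<open>The variable has weight 1, so \<open>N > 1\<close> and the first branch
    exists.\<close>
  moreover have "step bar (interleaving a N) Tau (Par (Prefix (Vis a) Stop) (word_proc (branch a 1)))"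
    using Var.prems(2) by (auto simp: step_interleaving)
  then have "\<exists>X. ([Tau], X) \<in> futs bar (interleaving a N)"
    by (auto simp: Cons_in_futs possible_futures_eq)
  ultimately have "\<exists>X. ([Tau], X) \<in> futs bar (\<sigma> y)" by blast
  then obtain s where "step bar (\<sigma> y) Tau s"
    unfolding Cons_in_futs by blast
  then show ?case
    using Var.prems(1) test_subst_step[of y "Var y" a N \<sigma>]
    by (metis active.simps(2) subst.simps(2))
next
  case (Plus t u)
  then show ?case by (auto simp: step_Plus_iff)
next
  case (Par t u)
  \<comment> \<open>A test step of one component lifts to the composition; the enlarged trace set
    keeps the long trace and the failure of inclusion.\<close>
  have up: ?case if t': "t' = t \<or> t' = u"
    and "\<exists>y p s. step bar (\<sigma> y) Tau s \<and> step bar (subst (test_subst bar a N \<sigma> y) t') Tau p \<and>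
      replicate N (Vis a) \<in> traces bar p \<and>
      (has_summand bar (interleaving a N) (\<sigma> y) \<or>
        \<not> traces bar p \<subseteq> traces bar (word_proc (replicate N (Vis a))))" for t'
  proof -
    from that(2) obtain y p s where y: "step bar (\<sigma> y) Tau s"
      "step bar (subst (test_subst bar a N \<sigma> y) t') Tau p" "replicate N (Vis a) \<in> traces bar p"
      "has_summand bar (interleaving a N) (\<sigma> y) \<or>
        \<not> traces bar p \<subseteq> traces bar (word_proc (replicate N (Vis a)))"
      by blast
    obtain p' where "step bar (subst (test_subst bar a N \<sigma> y) (Par t u)) Tau p'"
      "traces bar p \<subseteq> traces bar p'"
      using t' y(2) traces_Par_left traces_Par_right
      by (metis step.par_left step.par_right subst.simps(5))
    then show ?thesis using y by blast
  qed
  consider "dead bar (subst \<sigma> t)" | "dead bar (subst \<sigma> u)"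
    | "\<not> dead bar (subst \<sigma> t)" "\<not> dead bar (subst \<sigma> u)"
    by blast
  then show ?case
  proof cases
    case 1
    then show ?thesis using up[of u] Par by simp
  next
    case 2
    then show ?thesis using up[of t] up[of u] Par by (simp split: if_splits)
  next
    case 3
    then have eq: "pf_equiv bar (subst \<sigma> (Par t u)) (interleaving a N)"
      using Par.prems by simp
    have "N \<ge> 1" using Par.prems(2) by simp
    from interleaving_Tau_step[OF eq[simplified] this] show ?thesis
    proof (elim disjE exE)
      fix q assume "step bar (subst \<sigma> u) Tau q"
      from test_step_of_Par[OF eq 3(1) _ this] show ?thesis
        using Par.prems(2) by auto
    next
      fix q assume st: "step bar (subst \<sigma> t) Tau q"
      have "pf_equiv bar (subst \<sigma> (Par u t)) (interleaving a N)"
        using eq pf_equiv_Par_commute by (simp add: pf_equiv_def)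
      from test_step_of_Par[OF this 3(2) _ st] obtain y p s where y: "step bar (\<sigma> y) Tau s"
        "step bar (subst (test_subst bar a N \<sigma> y) (Par u t)) Tau p"
        "replicate N (Vis a) \<in> traces bar p"
        "\<not> traces bar p \<subseteq> traces bar (word_proc (replicate N (Vis a)))"
        using Par.prems(2) by auto
      let ?\<rho> = "test_subst bar a N \<sigma> y"
      have "([Tau], traces bar p) \<in> futs bar (subst ?\<rho> (Par u t))"
        using y(2) by (auto simp: Cons_in_futs possible_futures_eq)
      then have "([Tau], traces bar p) \<in> futs bar (subst ?\<rho> (Par t u))"
        using pf_equiv_Par_commute[of "subst ?\<rho> u" "subst ?\<rho> t"] by (simp add: pf_equiv_iff_futs)
      then obtain p' where "step bar (subst ?\<rho> (Par t u)) Tau p'" "traces bar p = traces bar p'"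
        by (auto simp: Cons_in_futs mem_possible_futures)
      then show ?thesis using y by auto
    qed
  qed
qed auto

text \<open>Backward half: a block of \<open>N\<close> visible steps is too long for a small term,
  so the observed step stems from \<open>y\<close> and locates the summand in which \<open>y\<close>
  runs.\<close>

lemma test_step_imp_has_summand:
  assumes "step bar (subst (test_subst bar a N \<sigma> y) u) Tau p"
    and "replicate N (Vis a) \<in> traces bar p"
    and "weight u < N"
    and "futs bar (subst \<sigma> u) \<subseteq> futs bar (interleaving a N)"
    and "has_summand bar (interleaving a N) (\<sigma> y) \<or>
      \<not> traces bar p \<subseteq> traces bar (word_proc (replicate N (Vis a)))"
    and tau: "step bar (\<sigma> y) Tau s"
  shows "has_summand bar (interleaving a N) (subst \<sigma> u)"
  using assms(1-5)
proof (induction u arbitrary: p)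
  \<comment> \<open>Only \<open>x = y\<close> has a \<open>Tau\<close> step, and its derivative is
    exactly the tested word, so the second alternative fails and \<open>\<sigma> y\<close> has the
    summand.\<close>
  case (Var x)
  then show ?case
    by (auto simp: test_subst_def split: if_splits)
next
  case (Prefix \<alpha> u)
  then have "replicate N (Vis a) \<in> traces bar (subst (test_subst bar a N \<sigma> y) u)"
    by auto
  then have "N \<le> weight u"
    by (rule order_trans[OF replicate_in_traces_le depth_before_tau_test_subst])
  with Prefix.prems show ?case by simp
next
  case (Plus t u)
  then show ?case by (auto simp: step_Plus_iff futs_Plus)
next
  case (Par t u)
  let ?\<rho> = "test_subst bar a N \<sigma> y"
  have dead_iff: "dead bar (subst ?\<rho> v) \<longleftrightarrow> dead bar (subst \<sigma> v)" for v
    using tau by (intro dead_test_subst) (auto simp: dead_def)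
  have fut: "([Tau], traces bar p) \<in> futs bar (Par (subst ?\<rho> t) (subst ?\<rho> u))"
    using Par.prems(1) by (auto simp: Cons_in_futs possible_futures_eq)
  have step_if: "\<exists>q. step bar r Tau q \<and> traces bar q = traces bar p"
    if "pf_equiv bar (Par (subst ?\<rho> t) (subst ?\<rho> u)) r" for r
    using that fut by (auto simp: pf_equiv_iff_futs Cons_in_futs mem_possible_futures)
  consider "dead bar (subst \<sigma> t)" | "\<not> dead bar (subst \<sigma> t)" "dead bar (subst \<sigma> u)"
    | "\<not> dead bar (subst \<sigma> t)" "\<not> dead bar (subst \<sigma> u)"
    by blast
  then show ?case
  proof cases
    case 1
    then obtain q where "step bar (subst ?\<rho> u) Tau q" "traces bar q = traces bar p"
      using step_if pf_equiv_Par_dead_left dead_iff by blast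
    moreover have "futs bar (subst \<sigma> u) \<subseteq> futs bar (interleaving a N)"
      using Par.prems(4) pf_equiv_Par_dead_left[OF 1] by (simp add: pf_equiv_iff_futs)
    ultimately show ?thesis using Par.IH(2)[of q] Par.prems 1 by simp
  next
    case 2
    then obtain q where "step bar (subst ?\<rho> t) Tau q" "traces bar q = traces bar p"
      using step_if pf_equiv_Par_dead_right dead_iff by blast
    moreover have "futs bar (subst \<sigma> t) \<subseteq> futs bar (interleaving a N)"
      using Par.prems(4) pf_equiv_Par_dead_right[OF 2(2)] by (simp add: pf_equiv_iff_futs)
    ultimately show ?thesis using Par.IH(1)[of q] Par.prems 2 by simp
  next
    case 3
    \<comment> \<open>Under \<open>\<sigma>\<close> the active \<open>y\<close> again provides a
      \<open>Tau\<close> step, as required for the decomposition of a live composition.\<close>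
    have "active y (Par t u)"
    proof (rule ccontr)
      assume "\<not> active y (Par t u)"
      from depth_before_tau_step_test_subst[OF Par.prems(1) this]
        replicate_in_traces_le[OF Par.prems(2)] Par.prems(3)
      show False by simp
    qed
    then obtain r where r: "step bar (subst \<sigma> t) Tau r \<or> step bar (subst \<sigma> u) Tau r"
      using active_step[of y t bar \<sigma>, OF _ tau] active_step[of y u bar \<sigma>, OF _ tau] by auto
    have "futs bar (Par (subst \<sigma> t) (subst \<sigma> u)) \<subseteq> futs bar (interleaving a N)"
      using Par.prems(4) by simp
    from Par_pf_equiv_interleaving[OF this 3 r] show ?thesis
      using 3 by simp
  qed
qed auto

section \<open>Invariance under derivations\<close>

text \<open>Soundness is used twice: under the test substitution to carry the observed future from
  \<open>t\<close> to \<open>u\<close>, and under \<open>\<sigma>\<close> to bound the futures of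
  \<open>u\<close>.\<close>

lemma sound_imp_has_summand:
  assumes sound: "\<And>\<sigma>. (\<forall>x. process (\<sigma> x)) \<Longrightarrow> pf_equiv bar (subst \<sigma> t) (subst \<sigma> u)"
    and small: "weight t < N" "weight u < N"
    and closed: "\<forall>x. process (\<sigma> x)"
    and eq: "pf_equiv bar (subst \<sigma> t) (interleaving a N)"
    and "has_summand bar (interleaving a N) (subst \<sigma> t)"
  shows "has_summand bar (interleaving a N) (subst \<sigma> u)"
proof -
  obtain y p s where y: "step bar (\<sigma> y) Tau s"
    "step bar (subst (test_subst bar a N \<sigma> y) t) Tau p"
    "replicate N (Vis a) \<in> traces bar p"
    "has_summand bar (interleaving a N) (\<sigma> y) \<or>
      \<not> traces bar p \<subseteq> traces bar (word_proc (replicate N (Vis a)))"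
    using has_summand_imp_test_step[OF assms(6) small(1)] by blast
  let ?\<rho> = "test_subst bar a N \<sigma> y"
  have "([Tau], traces bar p) \<in> futs bar (subst ?\<rho> t)"
    using y(2) by (auto simp: Cons_in_futs possible_futures_eq)
  also have "futs bar (subst ?\<rho> t) = futs bar (subst ?\<rho> u)"
    unfolding pf_equiv_iff_futs[symmetric] by (rule sound) (simp add: process_test_subst)
  finally obtain q where q: "step bar (subst ?\<rho> u) Tau q" "traces bar p = traces bar q"
    by (auto simp: Cons_in_futs mem_possible_futures)
  have "futs bar (subst \<sigma> u) \<subseteq> futs bar (interleaving a N)"
    using sound[OF closed] eq by (simp add: pf_equiv_iff_futs)
  from test_step_imp_has_summand[OF q(1) _ small(2) this _ y(1)] show ?thesis
    using y(3,4) q(2) by simp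
qed

lemma pf_equiv_if_has_summand:
  assumes "has_summand bar r p" and "futs bar p \<subseteq> futs bar r"
  shows "pf_equiv bar p r"
  using futs_subset_if_has_summand[OF assms(1)] assms(2)
  by (simp add: pf_equiv_iff_futs)

text \<open>A component with the summand has all futures of \<open>r\<close>, and as part of the sum
  it has no others. It is thus equivalent to \<open>r\<close>, and the conditional hypothesis
  applies.\<close>

lemma has_summand_Plus_cong:
  assumes "pf_equiv bar p r \<longrightarrow> has_summand bar r p = has_summand bar r p'"
    and "pf_equiv bar q r \<longrightarrow> has_summand bar r q = has_summand bar r q'"
    and "pf_equiv bar p p'" and "pf_equiv bar q q'"
    and "pf_equiv bar (Plus p q) r"
  shows "has_summand bar r (Plus p q) = has_summand bar r (Plus p' q')"
proof -
  have sub: "futs bar p \<subseteq> futs bar r" "futs bar q \<subseteq> futs bar r"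
    "futs bar p' \<subseteq> futs bar r" "futs bar q' \<subseteq> futs bar r"
    using assms(3-5) by (auto simp: pf_equiv_iff_futs futs_Plus)
  have "has_summand bar r p = has_summand bar r p'"
    using assms(1,3) pf_equiv_if_has_summand[OF _ sub(1)] pf_equiv_if_has_summand[OF _ sub(3)]
    by (auto simp: pf_equiv_def)
  moreover have "has_summand bar r q = has_summand bar r q'"
    using assms(2,4) pf_equiv_if_has_summand[OF _ sub(2)] pf_equiv_if_has_summand[OF _ sub(4)]
    by (auto simp: pf_equiv_def)
  ultimately show ?thesis by simp
qed

text \<open>If one component is dead, the other is equivalent to \<open>r\<close>; if both are live,
  only the class of the composition matters.\<close>

lemma has_summand_Par_cong:
  assumes "pf_equiv bar p r \<longrightarrow> has_summand bar r p = has_summand bar r p'"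
    and "pf_equiv bar q r \<longrightarrow> has_summand bar r q = has_summand bar r q'"
    and p: "pf_equiv bar p p'" and q: "pf_equiv bar q q'"
    and eq: "pf_equiv bar (Par p q) r"
  shows "has_summand bar r (Par p q) = has_summand bar r (Par p' q')"
proof -
  have "pf_equiv bar q r" if "dead bar p"
    using pf_equiv_Par_dead_left[OF that] eq by (simp add: pf_equiv_def)
  moreover have "pf_equiv bar p r" if "dead bar q"
    using pf_equiv_Par_dead_right[OF that] eq by (simp add: pf_equiv_def)
  moreover have "pf_equiv bar (Par p' q') r"
    using pf_equiv_Par[OF p q] eq by (simp add: pf_equiv_def)
  ultimately show ?thesis
    using assms dead_cong[OF p] dead_cong[OF q] by simp
qed

text \<open>Quantifying over closing substitutions makes instantiation trivial and keeps the middle term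
  of a transitivity step closed.\<close>

lemma derivable_invariant:
  assumes "derivable E t u"
    and sound: "pf_sound bar E"
    and small: "\<forall>(t, u) \<in> E. weight t < N \<and> weight u < N"
    and "\<forall>x. process (\<sigma> x)"
  shows "pf_equiv bar (subst \<sigma> t) (subst \<sigma> u) \<and>
    (pf_equiv bar (subst \<sigma> t) (interleaving a N) \<longrightarrow>
      has_summand bar (interleaving a N) (subst \<sigma> t) = has_summand bar (interleaving a N) (subst \<sigma> u))"
  using assms(1,4)
proof (induction arbitrary: \<sigma> rule: derivable.induct)
  case (ax t u)
  have tu: "pf_equiv bar (subst \<rho> t) (subst \<rho> u)" if "\<forall>x. process (\<rho> x)" for \<rho>
    using sound ax.hyps that unfolding pf_sound_def by blast
  then have ut: "pf_equiv bar (subst \<rho> u) (subst \<rho> t)" if "\<forall>x. process (\<rho> x)" for \<rho>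
    using that by (simp add: pf_equiv_def)
  have w: "weight t < N" "weight u < N"
    using small ax.hyps by auto
  show ?case
  proof (intro conjI impI iffI)
    show "pf_equiv bar (subst \<sigma> t) (subst \<sigma> u)" by (rule tu[OF ax.prems])
    assume eq: "pf_equiv bar (subst \<sigma> t) (interleaving a N)"
    then have eq': "pf_equiv bar (subst \<sigma> u) (interleaving a N)"
      using tu[OF ax.prems] by (simp add: pf_equiv_def)
    show "has_summand bar (interleaving a N) (subst \<sigma> u)"
      if "has_summand bar (interleaving a N) (subst \<sigma> t)"
      using sound_imp_has_summand[OF tu w ax.prems eq that] .
    show "has_summand bar (interleaving a N) (subst \<sigma> t)"
      if "has_summand bar (interleaving a N) (subst \<sigma> u)"
      using sound_imp_has_summand[OF ut w(2,1) ax.prems eq' that] .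
  qed
next
  case (refl t)
  then show ?case by (simp add: pf_equiv_def)
next
  case (sym t u)
  from sym.IH[OF sym.prems] show ?case by (auto simp: pf_equiv_def)
next
  case (trans t u v)
  from trans.IH(1)[OF trans.prems] trans.IH(2)[OF trans.prems] show ?case
    by (auto simp: pf_equiv_def)
next
  case (inst t u \<rho>)
  have "\<forall>x. process ((subst \<sigma> \<circ> \<rho>) x)"
    using process_subst[OF inst.prems] by simp
  from inst.IH[OF this] show ?case unfolding subst_subst .
next
  case (cong_prefix t u \<alpha>)
  then show ?case by (simp add: pf_equiv_Prefix)
next
  case (cong_plus t u t' u')
  note t = cong_plus.IH(1)[OF cong_plus.prems] and t' = cong_plus.IH(2)[OF cong_plus.prems]
  show ?case
    using has_summand_Plus_cong[OF t[THEN conjunct2] t'[THEN conjunct2] t[THEN conjunct1]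
        t'[THEN conjunct1]] t t'
    by (simp add: pf_equiv_iff_futs futs_Plus)
next
  case (cong_par t u t' u')
  note t = cong_par.IH(1)[OF cong_par.prems] and t' = cong_par.IH(2)[OF cong_par.prems]
  show ?case
    using has_summand_Par_cong[OF t[THEN conjunct2] t'[THEN conjunct2] t[THEN conjunct1]
        t'[THEN conjunct1]] pf_equiv_Par[OF t[THEN conjunct1] t'[THEN conjunct1]]
    by simp
qed

text \<open>\<open>N \<ge> 1\<close> makes \<open>branches a N\<close> live, so no component is
  skipped.\<close>

lemma has_summand_interleaving:
  assumes "N \<ge> 1"
  shows "has_summand bar (interleaving a N) (interleaving a N)"
proof -
  have "\<not> dead bar (branches a N)"
    using assms by (auto simp: dead_def step_branches)
  then show ?thesis
    by (simp add: interleaving_def pf_equiv_def)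
qed

lemma not_derivable_expansion:
  assumes "pf_sound bar E" and "\<forall>(t, u) \<in> E. weight t < N \<and> weight u < N" and "N \<ge> 1"
  shows "\<not> derivable E (interleaving a N) (expansion a N)"
proof
  assume "derivable E (interleaving a N) (expansion a N)"
  \<comment> \<open>Any closing substitution will do, since both sides are closed.\<close>
  from derivable_invariant[OF this assms(1,2), of "\<lambda>_. Stop" a] show False
    using has_summand_interleaving[OF assms(3), of a]
    by (simp add: pf_equiv_def not_has_summand_expansion
      subst_process[OF process_interleaving] subst_process[OF process_expansion])
qed

end

section \<open>Non-existence of a finite ground-complete axiomatisation\<close>

theorem theorem7p1:
  fixes bar :: "'a::finite \<Rightarrow> 'a"
  assumes "bij bar"
    and "\<And>a. bar (bar a) = a"
    and "\<And>a. bar a \<noteq> a"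
    and "card (UNIV :: 'a act set) \<ge> 2"
  shows "\<not> (\<exists>E :: ('a trm \<times> 'a trm) set.
    finite E \<and> pf_sound bar E \<and> pf_ground_complete bar E)"
proof clarify
  interpret complementation bar
    by unfold_locales (fact assms)+
  fix E :: "('a trm \<times> 'a trm) set"
  assume E: "finite E" "pf_sound bar E" "pf_ground_complete bar E"
  have "finite ((\<lambda>(t, u). weight t + weight u) ` E)"
    using E(1) by simp
  then obtain n where n: "\<forall>k \<in> (\<lambda>(t, u). weight t + weight u) ` E. k < n"
    unfolding finite_nat_set_iff_bounded by blast
  \<comment> \<open>The bound \<open>n\<close> may be 0 if \<open>E\<close> is empty;
    \<open>Suc n\<close> guarantees at least one branch.\<close>
  then have "\<forall>(t, u) \<in> E. weight t < Suc n \<and> weight u < Suc n"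
    by fastforce
  then have "\<not> derivable E (interleaving a (Suc n)) (expansion a (Suc n))" for a
    using not_derivable_expansion E(2) by simp
  moreover have "derivable E (interleaving a (Suc n)) (expansion a (Suc n))" for a
    using E(3)[unfolded pf_ground_complete_def, rule_format,
        OF process_interleaving process_expansion pf_equiv_expansion] .
  ultimately show False by blast
qed

end
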